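(* Let $X$ and $Y$ be any digital images with basepoints $x_0\in X$ and $y_0\in Y$. Let $p_1\colon X\times Y\to X$ and $p_2\colon X\times Y\to Y$ denote the projections onto either factor. Define a map $$\Psi\colon \pi_1\big(X\times Y;(x_0,y_0)\big)\to\pi_1(X;x_0)\times\pi_1(Y;y_0)$$ by $\Psi([\alpha])=\big((p_1)_*([\alpha]),(p_2)_*([\alpha])\big)$ for each $[\alpha]\in\pi_1\big(X\times Y;(x_0,y_0)\big)$. Then $\Psi$ is an isomorphism.
   Context: A digital image is a finite subset $X \subseteq \mathbb{Z}^n$ with adjacency relation $x \sim_X x'$ iff $|x_i - x'_i| \le 1$ for every $i=1,\dots,n$. A function of digital images is continuous if it sends adjacent points to adjacent points; a based map is a continuous function preserving basepoints. The product of $X\subseteq\mathbb{Z}^m$ and $Y\subseteq\mathbb{Z}^n$ is $X\times Y\subseteq\mathbb{Z}^{m+n}$, with $(x,y)\sim(x',y')$ iff $x\sim_X x'$ and $y\sim_Y y'$, and basepoint $(x_0,y_0)$. $I_N = \{0,1,\dots,N\}\subseteq\mathbb{Z}$. For a based digital image $(Y,y_0)$, a based loop of length $N\ge 1$ is a continuous $\gamma\colon I_N\to Y$ with $\gamma(0)=\gamma(N)=y_0$. Based loops $\alpha,\beta\colon I_M\to Y$ are based homotopic as based loops, $\alpha\approx\beta$, if for some $R\ge1$ there is a continuous $H\colon I_M\times I_R\to Y$ with $H(s,0)=\alpha(s)$, $H(s,R)=\beta(s)$ and $H(0,t)=H(M,t)=y_0$ for all $s,t$. For $k\ge1$, $\rho_k\colon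 I_{kN+k-1}\to I_N$ is $\rho_k(s)=\lfloor s/k\rfloor$. Based loops $\alpha\colon I_M\to Y$, $\beta\colon I_N\to Y$ are subdivision-based homotopic as based loops if for some $k,l\ge1$ with $k(M+1)=l(N+1)$ we have $\alpha\circ\rho_k\approx\beta\circ\rho_l$ as based loops. This is an equivalence relation; $[\alpha]$ is the class of $\alpha$ and $\pi_1(Y;y_0)$ the set of classes. It is a group under $[\alpha]\cdot[\beta]=[\alpha\cdot\beta]$, where $\alpha\cdot\beta\colon I_{M+N+1}\to Y$ is $\alpha(t)$ for $0\le t\le M$ and $\beta(t-(M+1))$ for $M+1\le t\le M+N+1$. A based map $f\colon X\to Y$ induces the homomorphism $f_*\colon\pi_1(X;x_0)\to\pi_1(Y;y_0)$, $f_*([\alpha])=[f\circ\alpha]$. *)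

theory Defs
  imports "HOL-Analysis.Finite_Cartesian_Product" "HOL-Analysis.Cartesian_Space" "HOL-Algebra.Group"
begin

text \<open>
  A digital image in \<open>\<int>\<^sup>n\<close> is a finite \<open>X :: (int ^ 'n) set\<close>. Its adjacency \<open>\<sim>\<^sub>X\<close> is the restriction
  of \<open>adj\<close> to \<open>X\<close>; note that \<open>adj\<close> is reflexive.
\<close>

definition digital_image :: "(int ^ 'n) set \<Rightarrow> bool" where
  "digital_image X \<longleftrightarrow> finite X"

definition adj :: "int ^ 'n \<Rightarrow> int ^ 'n \<Rightarrow> bool" where
  "adj x x' \<longleftrightarrow> (\<forall>i. \<bar>x $ i - x' $ i\<bar> \<le> 1)"

definition digitally_continuous ::
    "(int ^ 'm) set \<Rightarrow> (int ^ 'n) set \<Rightarrow> (int ^ 'm \<Rightarrow> int ^ 'n) \<Rightarrow> bool" where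
  "digitally_continuous X Y f \<longleftrightarrow>
     f ` X \<subseteq> Y \<and> (\<forall>x\<in>X. \<forall>x'\<in>X. adj x x' \<longrightarrow> adj (f x) (f x'))"

text \<open>\<open>\<int>\<^sup>m\<^sup>+\<^sup>n\<close> is rendered with the sum of the two index types.\<close>

definition vec_append :: "int ^ 'm \<Rightarrow> int ^ 'n \<Rightarrow> int ^ ('m::finite + 'n::finite)" where
  "vec_append x y = (\<chi> i. case i of Inl a \<Rightarrow> x $ a | Inr b \<Rightarrow> y $ b)"

definition proj1 :: "int ^ ('m::finite + 'n::finite) \<Rightarrow> int ^ 'm" where
  "proj1 z = (\<chi> a. z $ Inl a)"

definition proj2 :: "int ^ ('m::finite + 'n::finite) \<Rightarrow> int ^ 'n" where
  "proj2 z = (\<chi> b. z $ Inr b)"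

definition digital_prod :: "(int ^ 'm) set \<Rightarrow> (int ^ 'n) set \<Rightarrow> (int ^ ('m::finite + 'n::finite)) set" where
  "digital_prod X Y = {vec_append x y | x y. x \<in> X \<and> y \<in> Y}"

text \<open>
  The interval \<open>I\<^sub>N\<close> is a digital image in \<open>\<int>\<^sup>1\<close>; an integer \<open>s\<close> is identified with \<open>vec s :: int ^ 1\<close>.
\<close>

definition interval :: "nat \<Rightarrow> (int ^ 1) set" where
  "interval N = vec ` {0..int N}"

text \<open>
  A loop is a length together with a function. The values of the function off \<open>interval N\<close> are
  irrelevant: \<open>loop_rel\<close> depends on the functions only through their values on the intervals, and
  loops of the same length that agree on their interval are related by a constant homotopy.
\<close>

type_synonym 'n dloop = "nat \<times> ((int, 1) vec \<Rightarrow> (int, 'n) vec)"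

definition loops :: "(int ^ 'n) set \<Rightarrow> int ^ 'n \<Rightarrow> 'n dloop set" where
  "loops Y y0 = {(N, \<gamma>). 1 \<le> N \<and> digitally_continuous (interval N) Y \<gamma> \<and>
     \<gamma> (vec 0) = y0 \<and> \<gamma> (vec (int N)) = y0}"

definition loop_homotopic ::
    "(int ^ 'n) set \<Rightarrow> int ^ 'n \<Rightarrow> nat \<Rightarrow> (int ^ 1 \<Rightarrow> int ^ 'n) \<Rightarrow> (int ^ 1 \<Rightarrow> int ^ 'n) \<Rightarrow> bool" where
  "loop_homotopic Y y0 M \<alpha> \<beta> \<longleftrightarrow>
     (\<exists>R\<ge>1. \<exists>H. digitally_continuous (digital_prod (interval M) (interval R)) Y H \<and>
        (\<forall>s\<in>interval M. H (vec_append s (vec 0)) = \<alpha> s \<and> H (vec_append s (vec (int R))) = \<beta> s) \<and>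
        (\<forall>t\<in>interval R. H (vec_append (vec 0) t) = y0 \<and> H (vec_append (vec (int M)) t) = y0))"

definition rho :: "nat \<Rightarrow> int ^ 1 \<Rightarrow> int ^ 1" where
  "rho k s = vec ((s $ 1) div int k)"

definition loop_rel :: "(int ^ 'n) set \<Rightarrow> int ^ 'n \<Rightarrow> ('n dloop \<times> 'n dloop) set" where
  "loop_rel Y y0 = {((M, \<alpha>), (N, \<beta>)). (M, \<alpha>) \<in> loops Y y0 \<and> (N, \<beta>) \<in> loops Y y0 \<and>
     (\<exists>k\<ge>1. \<exists>l\<ge>1. k * (M + 1) = l * (N + 1) \<and>
        loop_homotopic Y y0 (k * M + k - 1) (\<alpha> \<circ> rho k) (\<beta> \<circ> rho l))}"

definition loop_class :: "(int ^ 'n) set \<Rightarrow> int ^ 'n \<Rightarrow> 'n dloop \<Rightarrow> 'n dloop set" where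
  "loop_class Y y0 a = loop_rel Y y0 `` {a}"

definition loop_concat :: "'n::finite dloop \<Rightarrow> 'n dloop \<Rightarrow> 'n dloop" where
  "loop_concat = (\<lambda>(M, \<alpha>) (N, \<beta>).
     (M + N + 1, \<lambda>t. if t $ 1 \<le> int M then \<alpha> t else \<beta> (t - vec (int (M + 1)))))"

text \<open>
  Operations on classes are given as unions over representatives, as in \<open>HOL.Equiv_Relations\<close>: when
  the operation on representatives respects the relation, the union is the single class of any
  representative's image.
\<close>

definition fundamental_group :: "(int ^ 'n) set \<Rightarrow> int ^ 'n \<Rightarrow> 'n dloop set monoid" where
  "fundamental_group Y y0 =
     \<lparr>carrier = loops Y y0 // loop_rel Y y0,
      mult = (\<lambda>A B. \<Union>a\<in>A. \<Union>b\<in>B. loop_class Y y0 (loop_concat a b)),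
      one = loop_class Y y0 (1, \<lambda>_. y0)\<rparr>"

definition induced :: "(int ^ 'n) set \<Rightarrow> int ^ 'n \<Rightarrow> (int ^ 'm \<Rightarrow> int ^ 'n) \<Rightarrow>
    'm dloop set \<Rightarrow> 'n dloop set" where
  "induced Y y0 f A = (\<Union>(N, \<alpha>)\<in>A. loop_class Y y0 (N, f \<circ> \<alpha>))"

definition Psi :: "(int ^ 'm) set \<Rightarrow> int ^ 'm \<Rightarrow> (int ^ 'n) set \<Rightarrow> int ^ 'n \<Rightarrow>
    ('m::finite + 'n::finite) dloop set \<Rightarrow> 'm dloop set \<times> 'n dloop set" where
  "Psi X x0 Y y0 A = (induced X x0 proj1 A, induced Y y0 proj2 A)"

end

theory Submission
  imports Defs
begin

text \<open>
  A map into a product is continuous exactly when both its components are, and the same holds for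
  homotopies. So a loop in \<open>X \<times> Y\<close> is a pair of loops of equal length, and a based homotopy of such
  loops is a pair of based homotopies with equal numbers of time steps. The two obstacles are these
  equalities. A homotopy that ends early can be prolonged by standing still
  (\<open>grid_homotopy_extend\<close>). Loops \<open>a\<close> and \<open>b\<close> with \<open>M + 1\<close> and \<open>N + 1\<close> points become equally long
  when they are subdivided by \<open>N + 1\<close> and \<open>M + 1\<close>, and subdividing does not change the class; this
  gives surjectivity of \<open>\<Psi>\<close> (\<open>ex_loop_in_prod\<close>). For injectivity (\<open>loop_rel_prodI\<close>), the two
  coordinates of \<open>c\<close> and \<open>d\<close> may be related through different pairs of subdivision factors
  \<open>(k, l)\<close> and \<open>(k', l')\<close>, but both are in the ratio of the numbers of points of \<open>d\<close> and \<open>c\<close>, so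
  subdividing further by \<open>k'\<close> and by \<open>k\<close> makes them agree.

  A projection commutes with concatenation already on the level of loops, so \<open>\<Psi>\<close> is a homomorphism
  as soon as concatenation is well defined on classes. This is the harder part. Representatives \<open>a'\<close>
  of \<open>[a]\<close> and \<open>b'\<close> of \<open>[b]\<close> may need to be subdivided in different proportions, and then the concatenation of the
  subdivided loops is in general no subdivision of \<open>a \<cdot> b\<close>: they run through the same points with
  different changes of speed. \<open>based_homotopic_reparametrization\<close> removes the difference: two
  parametrisations of one loop by rounded-down real functions of slope at most \<open>1/2\<close> are homotopic,
  by rounding down the straight line between the real functions.
\<close>

section \<open>Homotopies on integer grids\<close>

text \<open>
  A homotopy is easier to write down as a function of two integers than as a function on \<open>\<int>\<^sup>1\<^sup>+\<^sup>1\<close>.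
  Here \<open>R = 0\<close> is permitted, so that a single loop counts as its own homotopy; this is no more
  general, since a homotopy may be prolonged.
\<close>

definition grid_homotopy ::
    "(int ^ 'n) set \<Rightarrow> int ^ 'n \<Rightarrow> nat \<Rightarrow> nat \<Rightarrow> (int \<Rightarrow> int \<Rightarrow> int ^ 'n) \<Rightarrow>
     (int ^ 1 \<Rightarrow> int ^ 'n) \<Rightarrow> (int ^ 1 \<Rightarrow> int ^ 'n) \<Rightarrow> bool" where
  "grid_homotopy Y y0 M R K \<alpha> \<beta> \<longleftrightarrow>
     (\<forall>s\<in>{0..int M}. \<forall>t\<in>{0..int R}. K s t \<in> Y \<and>
        (\<forall>s'\<in>{0..int M}. \<forall>t'\<in>{0..int R}. \<bar>s - s'\<bar> \<le> 1 \<longrightarrow> \<bar>t - t'\<bar> \<le> 1 \<longrightarrow> adj (K s t) (K s' t'))) \<and>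
     (\<forall>s\<in>{0..int M}. K s 0 = \<alpha> (vec s) \<and> K s (int R) = \<beta> (vec s)) \<and>
     (\<forall>t\<in>{0..int R}. K 0 t = y0 \<and> K (int M) t = y0)"

text \<open>
  The relation \<open>\<approx>\<close> on loops as pairs, restricted to positive lengths. Being a loop is part of it: it
  is a partial equivalence relation whose domain is the set of loops (\<open>loops_iff_based_homotopic\<close>).
  Hence for each operation below it suffices to show that it respects \<open>\<approx>\<close>; that it preserves loops
  is the diagonal case.
\<close>

definition based_homotopic :: "(int ^ 'n) set \<Rightarrow> int ^ 'n \<Rightarrow> 'n dloop \<Rightarrow> 'n dloop \<Rightarrow> bool" where
  "based_homotopic Y y0 a b \<longleftrightarrow> fst a = fst b \<and> 1 \<le> fst a \<and>
     (\<exists>R K. grid_homotopy Y y0 (fst a) R K (snd a) (snd b))"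

lemma adj_refl [simp]: "adj x x"
  by (simp add: adj_def)

lemma adj_vec [simp]: "adj (vec s :: int ^ 1) (vec t) \<longleftrightarrow> \<bar>s - t\<bar> \<le> 1"
  by (simp add: adj_def)

lemma adj_vec_append [simp]:
  "adj (vec_append x y) (vec_append x' y') \<longleftrightarrow> adj x x' \<and> adj y y'"
  by (auto simp: adj_def vec_append_def split: sum.splits)

lemma vec_append_nth [simp]:
  "vec_append x y $ Inl i = x $ i" "vec_append x y $ Inr j = y $ j"
  by (simp_all add: vec_append_def)

lemma grid_homotopyI:
  assumes "\<And>s t. 0 \<le> s \<Longrightarrow> s \<le> int M \<Longrightarrow> 0 \<le> t \<Longrightarrow> t \<le> int R \<Longrightarrow> K s t \<in> Y"
    and "\<And>s t s' t'. 0 \<le> s \<Longrightarrow> s \<le> int M \<Longrightarrow> 0 \<le> t \<Longrightarrow> t \<le> int R \<Longrightarrow>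
           0 \<le> s' \<Longrightarrow> s' \<le> int M \<Longrightarrow> 0 \<le> t' \<Longrightarrow> t' \<le> int R \<Longrightarrow>
           \<bar>s - s'\<bar> \<le> 1 \<Longrightarrow> \<bar>t - t'\<bar> \<le> 1 \<Longrightarrow> adj (K s t) (K s' t')"
    and "\<And>s. 0 \<le> s \<Longrightarrow> s \<le> int M \<Longrightarrow> K s 0 = \<alpha> (vec s)"
    and "\<And>s. 0 \<le> s \<Longrightarrow> s \<le> int M \<Longrightarrow> K s (int R) = \<beta> (vec s)"
    and "\<And>t. 0 \<le> t \<Longrightarrow> t \<le> int R \<Longrightarrow> K 0 t = y0"
    and "\<And>t. 0 \<le> t \<Longrightarrow> t \<le> int R \<Longrightarrow> K (int M) t = y0"
  shows "grid_homotopy Y y0 M R K \<alpha> \<beta>"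
  using assms unfolding grid_homotopy_def by auto

lemma grid_homotopyD:
  assumes "grid_homotopy Y y0 M R K \<alpha> \<beta>"
  shows "0 \<le> s \<Longrightarrow> s \<le> int M \<Longrightarrow> 0 \<le> t \<Longrightarrow> t \<le> int R \<Longrightarrow> K s t \<in> Y"
    and "0 \<le> s \<Longrightarrow> s \<le> int M \<Longrightarrow> 0 \<le> t \<Longrightarrow> t \<le> int R \<Longrightarrow>
           0 \<le> s' \<Longrightarrow> s' \<le> int M \<Longrightarrow> 0 \<le> t' \<Longrightarrow> t' \<le> int R \<Longrightarrow>
           \<bar>s - s'\<bar> \<le> 1 \<Longrightarrow> \<bar>t - t'\<bar> \<le> 1 \<Longrightarrow> adj (K s t) (K s' t')"
    and "0 \<le> s \<Longrightarrow> s \<le> int M \<Longrightarrow> K s 0 = \<alpha> (vec s)"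
    and "0 \<le> s \<Longrightarrow> s \<le> int M \<Longrightarrow> K s (int R) = \<beta> (vec s)"
    and "0 \<le> t \<Longrightarrow> t \<le> int R \<Longrightarrow> K 0 t = y0"
    and "0 \<le> t \<Longrightarrow> t \<le> int R \<Longrightarrow> K (int M) t = y0"
  using assms unfolding grid_homotopy_def by auto

text \<open>
  Waiting at the final loop keeps continuity because \<open>t \<mapsto> min t R\<close> moves adjacent times to adjacent
  times. This is how two homotopies are given the same number of time steps.
\<close>

lemma grid_homotopy_extend:
  assumes "grid_homotopy Y y0 M R K \<alpha> \<beta>" and "R \<le> R'"
  shows "grid_homotopy Y y0 M R' (\<lambda>s t. K s (min t (int R))) \<alpha> \<beta>"
proof (rule grid_homotopyI)
  note KD = grid_homotopyD[OF assms(1)]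
  fix s t s' t'
  assume "0 \<le> s" "s \<le> int M" "0 \<le> t" "t \<le> int R'" "0 \<le> s'" "s' \<le> int M" "0 \<le> t'" "t' \<le> int R'"
    "\<bar>s - s'\<bar> \<le> 1" "\<bar>t - t'\<bar> \<le> 1"
  then show "adj (K s (min t (int R))) (K s' (min t' (int R)))"
    by (intro KD(2)) auto
qed (use assms(2) grid_homotopyD[OF assms(1)] in \<open>auto simp: min_def\<close>)

lemma based_homotopicI:
  "grid_homotopy Y y0 M R K \<alpha> \<beta> \<Longrightarrow> 1 \<le> M \<Longrightarrow> based_homotopic Y y0 (M, \<alpha>) (M, \<beta>)"
  by (auto simp: based_homotopic_def)

lemma based_homotopicE:
  assumes "based_homotopic Y y0 a b"
  obtains M \<alpha> \<beta> R K where "a = (M, \<alpha>)" "b = (M, \<beta>)" "1 \<le> M" "grid_homotopy Y y0 M R K \<alpha> \<beta>"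
  using assms by (cases a; cases b) (auto simp: based_homotopic_def)

lemma loop_homotopic_iff:
  "loop_homotopic Y y0 M \<alpha> \<beta> \<longleftrightarrow> (\<exists>R K. grid_homotopy Y y0 M R K \<alpha> \<beta>)"
proof
  assume "loop_homotopic Y y0 M \<alpha> \<beta>"
  then obtain R H where H: "digitally_continuous (digital_prod (interval M) (interval R)) Y H"
      "\<forall>s\<in>interval M. H (vec_append s (vec 0)) = \<alpha> s \<and> H (vec_append s (vec (int R))) = \<beta> s"
      "\<forall>t\<in>interval R. H (vec_append (vec 0) t) = y0 \<and> H (vec_append (vec (int M)) t) = y0"
    unfolding loop_homotopic_def by blast
  have mem: "vec_append (vec s) (vec t) \<in> digital_prod (interval M) (interval R)"
    if "0 \<le> s" "s \<le> int M" "0 \<le> t" "t \<le> int R" for s t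
    using that unfolding digital_prod_def interval_def by fastforce
  have "grid_homotopy Y y0 M R (\<lambda>s t. H (vec_append (vec s) (vec t))) \<alpha> \<beta>"
    using H mem unfolding digitally_continuous_def
    by (intro grid_homotopyI) (auto simp: interval_def)
  then show "\<exists>R K. grid_homotopy Y y0 M R K \<alpha> \<beta>" by blast
next
  assume "\<exists>R K. grid_homotopy Y y0 M R K \<alpha> \<beta>"
  then obtain R K where "grid_homotopy Y y0 M R K \<alpha> \<beta>" by blast
  \<comment> \<open>One extra step, because \<open>loop_homotopic\<close> asks for at least one.\<close>
  then have K: "grid_homotopy Y y0 M (Suc R) (\<lambda>s t. K s (min t (int R))) \<alpha> \<beta>"
      (is "grid_homotopy _ _ _ _ ?K _ _")
    by (rule grid_homotopy_extend) simp
  let ?H = "\<lambda>z :: int ^ (1 + 1). ?K (z $ Inl 1) (z $ Inr 1)"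
  note KD = grid_homotopyD[OF K]
  have "digitally_continuous (digital_prod (interval M) (interval (Suc R))) Y ?H"
    unfolding digitally_continuous_def
  proof (intro conjI ballI impI)
    show "?H ` digital_prod (interval M) (interval (Suc R)) \<subseteq> Y"
      using KD(1) by (auto simp: digital_prod_def interval_def)
  next
    fix z z' :: "int ^ (1 + 1)"
    assume "z \<in> digital_prod (interval M) (interval (Suc R))"
      "z' \<in> digital_prod (interval M) (interval (Suc R))" "adj z z'"
    then obtain s t s' t' where
      "z = vec_append (vec s) (vec t)" "z' = vec_append (vec s') (vec t')"
      "0 \<le> s" "s \<le> int M" "0 \<le> t" "t \<le> int (Suc R)"
      "0 \<le> s'" "s' \<le> int M" "0 \<le> t'" "t' \<le> int (Suc R)"
      "\<bar>s - s'\<bar> \<le> 1" "\<bar>t - t'\<bar> \<le> 1"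
      by (auto simp: digital_prod_def interval_def)
    then show "adj (?H z) (?H z')"
      using KD(2)[of s t s' t'] by simp
  qed
  moreover have "\<forall>s\<in>interval M. ?H (vec_append s (vec 0)) = \<alpha> s \<and>
      ?H (vec_append s (vec (int (Suc R)))) = \<beta> s"
    using KD(3,4) by (auto simp: interval_def)
  moreover have "\<forall>t\<in>interval (Suc R). ?H (vec_append (vec 0) t) = y0 \<and>
      ?H (vec_append (vec (int M)) t) = y0"
    using KD(5,6) by (auto simp: interval_def)
  ultimately show "loop_homotopic Y y0 M \<alpha> \<beta>"
    unfolding loop_homotopic_def
    by (intro exI[of _ "Suc R"] conjI exI[of _ ?H]) simp_all
qed

section \<open>Based homotopy of loops\<close>

lemma loops_iff_based_homotopic: "a \<in> loops Y y0 \<longleftrightarrow> based_homotopic Y y0 a a"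
proof (cases a)
  case (Pair N \<gamma>)
  show ?thesis
  proof
    assume "a \<in> loops Y y0"
    then have "grid_homotopy Y y0 N 0 (\<lambda>s _. \<gamma> (vec s)) \<gamma> \<gamma>" "1 \<le> N"
      unfolding Pair loops_def digitally_continuous_def
      by (auto intro!: grid_homotopyI simp: interval_def)
    then show "based_homotopic Y y0 a a"
      unfolding Pair by (rule based_homotopicI)
  next
    assume "based_homotopic Y y0 a a"
    then obtain R K where K: "grid_homotopy Y y0 N R K \<gamma> \<gamma>" and N: "1 \<le> N"
      unfolding Pair based_homotopic_def by auto
    note KD = grid_homotopyD[OF K]
    have "digitally_continuous (interval N) Y \<gamma>"
      unfolding digitally_continuous_def interval_def
      using KD(1)[of _ 0] KD(2)[of _ 0 _ 0] KD(3) by auto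
    moreover have "\<gamma> (vec 0) = y0" "\<gamma> (vec (int N)) = y0"
      using KD(5)[of 0] KD(6)[of 0] KD(3)[of 0] KD(3)[of "int N"] by simp_all
    ultimately show "a \<in> loops Y y0"
      using N unfolding Pair loops_def by simp
  qed
qed

lemma based_homotopic_sym:
  assumes "based_homotopic Y y0 a b" shows "based_homotopic Y y0 b a"
proof -
  obtain M \<alpha> \<beta> R K where ab: "a = (M, \<alpha>)" "b = (M, \<beta>)" "1 \<le> M"
    and K: "grid_homotopy Y y0 M R K \<alpha> \<beta>"
    using assms by (elim based_homotopicE)
  have "grid_homotopy Y y0 M R (\<lambda>s t. K s (int R - t)) \<beta> \<alpha>"
    by (rule grid_homotopyI) (use grid_homotopyD[OF K] in auto)
  then show ?thesis unfolding ab by (rule based_homotopicI) fact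
qed

lemma based_homotopic_trans:
  assumes "based_homotopic Y y0 a b" and "based_homotopic Y y0 b c"
  shows "based_homotopic Y y0 a c"
proof -
  obtain M \<alpha> \<beta> R K where ab: "a = (M, \<alpha>)" "b = (M, \<beta>)" "1 \<le> M"
    and K: "grid_homotopy Y y0 M R K \<alpha> \<beta>"
    using assms(1) by (elim based_homotopicE)
  obtain \<gamma> S L where c: "c = (M, \<gamma>)" and L: "grid_homotopy Y y0 M S L \<beta> \<gamma>"
    using assms(2) ab by (auto elim: based_homotopicE)
  note KD = grid_homotopyD[OF K] and LD = grid_homotopyD[OF L]
  let ?H = "\<lambda>s t. if t \<le> int R then K s t else L s (t - int R)"
  \<comment> \<open>Both pieces agree at time \<open>R\<close>, and adjacent times never lie strictly on either side of \<open>R\<close>.\<close>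
  have second: "?H s t = L s (t - int R)" if "0 \<le> s" "s \<le> int M" "int R \<le> t" for s t
    using that KD(4)[of s] LD(3)[of s] by (cases "t = int R") auto
  have "grid_homotopy Y y0 M (R + S) ?H \<alpha> \<gamma>"
  proof (rule grid_homotopyI)
    fix s t s' t'
    assume *: "0 \<le> s" "s \<le> int M" "0 \<le> t" "t \<le> int (R + S)"
       "0 \<le> s'" "s' \<le> int M" "0 \<le> t'" "t' \<le> int (R + S)" "\<bar>s - s'\<bar> \<le> 1" "\<bar>t - t'\<bar> \<le> 1"
    consider "t \<le> int R" "t' \<le> int R" | "int R \<le> t" "int R \<le> t'"
      using *(10) by linarith
    then show "adj (?H s t) (?H s' t')"
    proof cases
      case 1
      then show ?thesis using KD(2)[of s t s' t'] * by simp
    next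
      case 2
      then show ?thesis using LD(2)[of s "t - int R" s' "t' - int R"] *
        by (simp only: second)
    qed
  next
    fix s assume "0 \<le> s" "s \<le> int M"
    then show "?H s (int (R + S)) = \<gamma> (vec s)"
      using second[of s "int (R + S)"] LD(4)[of s] by simp
  next
    fix s t assume "0 \<le> s" "s \<le> int M" "0 \<le> t" "t \<le> int (R + S)"
    then show "?H s t \<in> Y" using KD(1)[of s t] LD(1)[of s "t - int R"] by simp
  next
    fix t assume "0 \<le> t" "t \<le> int (R + S)"
    then show "?H 0 t = y0" "?H (int M) t = y0"
      using KD(5,6)[of t] LD(5,6)[of "t - int R"] by simp_all
  qed (use KD in simp)
  then show ?thesis unfolding ab c by (rule based_homotopicI) fact
qed

lemma based_homotopic_cong:
  assumes "a \<in> loops Y y0" and "fst a = fst b"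
    and "\<And>s. 0 \<le> s \<Longrightarrow> s \<le> int (fst a) \<Longrightarrow> snd a (vec s) = snd b (vec s)"
  shows "based_homotopic Y y0 a b"
  using assms unfolding loops_iff_based_homotopic based_homotopic_def grid_homotopy_def by auto

section \<open>Subdivision\<close>

definition subdivide :: "nat \<Rightarrow> 'n::finite dloop \<Rightarrow> 'n dloop" where
  "subdivide k = (\<lambda>(M, \<alpha>). (k * M + k - 1, \<alpha> \<circ> rho k))"

lemma fst_subdivide: "fst (subdivide k a) = k * (fst a + 1) - 1"
  by (simp add: subdivide_def case_prod_beta)

lemma snd_subdivide: "snd (subdivide k a) (vec s) = snd a (vec (s div int k))"
  by (simp add: subdivide_def rho_def case_prod_beta)

lemma subdivide_subdivide:
  assumes "1 \<le> k" "1 \<le> l" shows "subdivide k (subdivide l a) = subdivide (k * l) a"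
proof (rule prod_eqI)
  have "l * (fst a + 1) - 1 + 1 = l * (fst a + 1)"
    using assms by simp
  then show "fst (subdivide k (subdivide l a)) = fst (subdivide (k * l) a)"
    by (simp only: fst_subdivide mult.assoc)
  have "rho l (rho k s) = rho (k * l) s" for s
    by (simp add: rho_def zdiv_zmult2_eq)
  then show "snd (subdivide k (subdivide l a)) = snd (subdivide (k * l) a)"
    by (simp add: subdivide_def case_prod_beta fun_eq_iff)
qed

lemma subdivide_1 [simp]: "subdivide (Suc 0) a = a"
proof -
  have "rho (Suc 0) = id"
    by (simp add: rho_def fun_eq_iff vec_eq_iff)
  then show ?thesis by (simp add: subdivide_def case_prod_beta)
qed

lemma int_div_less_iff:
  fixes s t :: int assumes "1 \<le> k" shows "s div int k < t \<longleftrightarrow> s < t * int k"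
proof -
  have s: "s = s div int k * int k + s mod int k" "0 \<le> s mod int k" "s mod int k < int k"
    using assms by simp_all
  show ?thesis
  proof
    assume "s div int k < t"
    then have "(s div int k + 1) * int k \<le> t * int k" by (intro mult_right_mono) auto
    then show "s < t * int k" using s unfolding distrib_right by linarith
  next
    assume "s < t * int k"
    then have "s div int k * int k < t * int k" using s by linarith
    then show "s div int k < t" using mult_less_cancel_right_pos[of "int k"] assms by simp
  qed
qed

lemma div_in_interval:
  assumes "0 \<le> s" "s \<le> int (k * (M + 1) - 1)" "1 \<le> k"
  shows "0 \<le> s div int k" "s div int k \<le> int M"
proof -
  show "0 \<le> s div int k" using assms by (simp add: pos_imp_zdiv_nonneg_iff)
  have "s < (int M + 1) * int k"
    using assms by (simp add: of_nat_diff algebra_simps)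
  then have "s div int k < int M + 1"
    using int_div_less_iff[OF assms(3)] by blast
  then show "s div int k \<le> int M" by simp
qed

lemma abs_div_diff_le_1:
  fixes s s' :: int
  assumes "\<bar>s - s'\<bar> \<le> 1" "1 \<le> k" shows "\<bar>s div int k - s' div int k\<bar> \<le> 1"
proof -
  have *: "(x + 1) div int k \<le> x div int k + 1" for x
    using zdiv_mono1[of "x + 1" "x + int k" "int k"] assms(2) by simp
  have "s \<le> s' + 1" "s' \<le> s + 1" using assms by auto
  then have "s div int k \<le> (s' + 1) div int k" "s' div int k \<le> (s + 1) div int k"
    using assms(2) by (auto intro: zdiv_mono1)
  with *[of s] *[of s'] show ?thesis by linarith
qed

text \<open>
  Precomposing with \<open>\<rho>\<^sub>k\<close> in the space coordinate preserves homotopies: \<open>\<rho>\<^sub>k\<close> preserves adjacency and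
  takes the end points of the longer interval to those of the shorter.
\<close>

lemma based_homotopic_subdivide:
  assumes "based_homotopic Y y0 a b" and "1 \<le> k"
  shows "based_homotopic Y y0 (subdivide k a) (subdivide k b)"
proof -
  obtain M \<alpha> \<beta> R K where ab: "a = (M, \<alpha>)" "b = (M, \<beta>)" "1 \<le> M"
    and K: "grid_homotopy Y y0 M R K \<alpha> \<beta>"
    using assms by (elim based_homotopicE)
  note KD = grid_homotopyD[OF K]
  have last: "int (k * (M + 1) - 1) div int k = int M"
  proof -
    have "int (k * (M + 1) - 1) = int k * int M + (int k - 1)"
      using assms(2) by (simp add: of_nat_diff algebra_simps)
    then show ?thesis
      by (rule int_div_pos_eq) (use assms(2) in auto)
  qed
  have "grid_homotopy Y y0 (k * (M + 1) - 1) R (\<lambda>s t. K (s div int k) t) (\<alpha> \<circ> rho k) (\<beta> \<circ> rho k)"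
  proof (rule grid_homotopyI)
    fix s t s' t'
    assume *: "0 \<le> s" "s \<le> int (k * (M + 1) - 1)" "0 \<le> t" "t \<le> int R"
      "0 \<le> s'" "s' \<le> int (k * (M + 1) - 1)" "0 \<le> t'" "t' \<le> int R" "\<bar>s - s'\<bar> \<le> 1" "\<bar>t - t'\<bar> \<le> 1"
    then show "adj (K (s div int k) t) (K (s' div int k) t')"
      by (intro KD(2) div_in_interval abs_div_diff_le_1 assms)
  next
    fix t assume "0 \<le> t" "t \<le> int R"
    then show "K (int (k * (M + 1) - 1) div int k) t = y0"
      unfolding last by (rule KD(6))
  qed (use KD assms(2) div_in_interval in \<open>auto simp: rho_def\<close>)
  moreover have "2 \<le> k * (M + 1)"
    using ab(3) assms(2) mult_le_mono[of 1 k 2 "M + 1"] by simp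
  then have "1 \<le> k * (M + 1) - 1" by simp
  moreover have "k * (M + 1) - 1 = k * M + k - 1" by simp
  ultimately show ?thesis unfolding ab subdivide_def
    by (metis based_homotopicI case_prod_conv)
qed

lemma subdivide_loops: "a \<in> loops Y y0 \<Longrightarrow> 1 \<le> k \<Longrightarrow> subdivide k a \<in> loops Y y0"
  by (simp add: loops_iff_based_homotopic based_homotopic_subdivide)

section \<open>Subdivision-based homotopy is an equivalence relation\<close>

text \<open>
  The condition \<open>k (M + 1) = l (N + 1)\<close> says that the subdivided loops have equal length, which
  \<open>based_homotopic\<close> includes.
\<close>

lemma loop_rel_iff:
  "(a, b) \<in> loop_rel Y y0 \<longleftrightarrow> a \<in> loops Y y0 \<and> b \<in> loops Y y0 \<and>
     (\<exists>k\<ge>1. \<exists>l\<ge>1. based_homotopic Y y0 (subdivide k a) (subdivide l b))"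
proof (cases a, cases b)
  fix M \<alpha> N \<beta> assume ab: "a = (M, \<alpha>)" "b = (N, \<beta>)"
  show ?thesis
  proof (cases "a \<in> loops Y y0 \<and> b \<in> loops Y y0")
    case True
    have "k * (M + 1) = l * (N + 1) \<and>
        loop_homotopic Y y0 (k * M + k - 1) (\<alpha> \<circ> rho k) (\<beta> \<circ> rho l) \<longleftrightarrow>
        based_homotopic Y y0 (subdivide k a) (subdivide l b)" if "1 \<le> k" "1 \<le> l" for k l
    proof -
      have "1 \<le> fst (subdivide k a)"
        using subdivide_loops[of a Y y0 k] True that
        by (simp add: loops_iff_based_homotopic based_homotopic_def)
      moreover have "k * (M + 1) = l * (N + 1) \<longleftrightarrow> k * M + k - 1 = l * N + l - 1"
        using that by (cases k; cases l) auto
      ultimately show ?thesis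
        by (simp add: based_homotopic_def loop_homotopic_iff subdivide_def ab)
    qed
    with True show ?thesis by (auto simp: loop_rel_def ab)
  qed (auto simp: loop_rel_def ab)
qed

lemma loop_rel_if_based_homotopic:
  assumes "based_homotopic Y y0 a b" shows "(a, b) \<in> loop_rel Y y0"
proof -
  have "a \<in> loops Y y0" "b \<in> loops Y y0"
    unfolding loops_iff_based_homotopic
    using assms based_homotopic_sym based_homotopic_trans by blast+
  then show ?thesis
    unfolding loop_rel_iff using assms by (auto intro!: exI[of _ "Suc 0"])
qed

text \<open>
  Transitivity holds because two different subdivisions of the middle loop have a common further
  subdivision.
\<close>

lemma equiv_loop_rel: "equiv (loops Y y0) (loop_rel Y y0)"
proof (intro equivI)
  show "loop_rel Y y0 \<subseteq> loops Y y0 \<times> loops Y y0"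
    by (auto simp: loop_rel_def)
  show "refl_on (loops Y y0) (loop_rel Y y0)"
    by (auto simp: refl_on_def loops_iff_based_homotopic intro: loop_rel_if_based_homotopic)
  show "sym (loop_rel Y y0)"
    by (rule symI) (use based_homotopic_sym in \<open>unfold loop_rel_iff, blast\<close>)
  show "trans (loop_rel Y y0)"
  proof (rule transI)
    fix a b c assume "(a, b) \<in> loop_rel Y y0" "(b, c) \<in> loop_rel Y y0"
    then obtain k l k' l' where abc: "a \<in> loops Y y0" "c \<in> loops Y y0"
      and kl: "1 \<le> k" "1 \<le> l" "based_homotopic Y y0 (subdivide k a) (subdivide l b)"
      and kl': "1 \<le> k'" "1 \<le> l'" "based_homotopic Y y0 (subdivide k' b) (subdivide l' c)"
      unfolding loop_rel_iff by blast
    have "based_homotopic Y y0 (subdivide (k' * k) a) (subdivide (k' * l) b)"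
      using based_homotopic_subdivide[OF kl(3) kl'(1)] kl kl' by (simp add: subdivide_subdivide)
    moreover have "based_homotopic Y y0 (subdivide (l * k') b) (subdivide (l * l') c)"
      using based_homotopic_subdivide[OF kl'(3) kl(2)] kl kl' by (simp add: subdivide_subdivide)
    ultimately have "based_homotopic Y y0 (subdivide (k' * k) a) (subdivide (l * l') c)"
      by (metis based_homotopic_trans mult.commute)
    moreover have "1 \<le> k' * k" "1 \<le> l * l'" using kl kl' by auto
    ultimately show "(a, c) \<in> loop_rel Y y0"
      unfolding loop_rel_iff using abc by blast
  qed
qed

lemma loop_rel_sym: "(a, b) \<in> loop_rel Y y0 \<Longrightarrow> (b, a) \<in> loop_rel Y y0"
  using equiv_loop_rel[of Y y0] by (meson equivE symE)

lemma loop_rel_trans: "(a, b) \<in> loop_rel Y y0 \<Longrightarrow> (b, c) \<in> loop_rel Y y0 \<Longrightarrow> (a, c) \<in> loop_rel Y y0"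
  using equiv_loop_rel[of Y y0] by (meson equivE transE)

lemma subdivide_loop_rel:
  assumes "a \<in> loops Y y0" "1 \<le> k" shows "(subdivide k a, a) \<in> loop_rel Y y0"
proof -
  have "based_homotopic Y y0 (subdivide 1 (subdivide k a)) (subdivide k a)"
    using subdivide_loops[OF assms] by (simp add: loops_iff_based_homotopic)
  then show ?thesis
    unfolding loop_rel_iff using assms subdivide_loops[OF assms] by blast
qed

section \<open>Concatenation respects subdivision-based homotopy\<close>

lemma fst_loop_concat: "fst (loop_concat a b) = fst a + fst b + 1"
  by (simp add: loop_concat_def case_prod_beta)

lemma snd_loop_concat: "snd (loop_concat a b) (vec i) =
    (if i \<le> int (fst a) then snd a (vec i) else snd b (vec (i - (int (fst a) + 1))))"
proof -
  have "vec i - vec (int (fst a + 1)) = (vec (i - (int (fst a) + 1)) :: int ^ 1)"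
    by (simp add: vec_eq_iff)
  then show ?thesis by (simp only: loop_concat_def case_prod_beta snd_conv vec_component)
qed

text \<open>
  Two homotopies can be put side by side because both stay at the basepoint along the seam: the last
  column of the first and the first column of the second are constantly \<open>y0\<close>, whatever the times.
\<close>

lemma based_homotopic_concat:
  assumes "based_homotopic Y y0 a a'" and "based_homotopic Y y0 b b'"
  shows "based_homotopic Y y0 (loop_concat a b) (loop_concat a' b')"
proof -
  obtain M \<alpha> \<alpha>' R K where a: "a = (M, \<alpha>)" "a' = (M, \<alpha>')" "1 \<le> M"
    and K: "grid_homotopy Y y0 M R K \<alpha> \<alpha>'"
    using assms(1) by (elim based_homotopicE)
  obtain N \<beta> \<beta>' S L where b: "b = (N, \<beta>)" "b' = (N, \<beta>')"
    and L: "grid_homotopy Y y0 N S L \<beta> \<beta>'"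
    using assms(2) by (elim based_homotopicE)
  let ?c = "snd (loop_concat (M, \<alpha>) (N, \<beta>))" and ?c' = "snd (loop_concat (M, \<alpha>') (N, \<beta>'))"
  let ?K = "\<lambda>s t. K s (min t (int R))" and ?L = "\<lambda>s t. L s (min t (int S))"
  note KD = grid_homotopyD[OF grid_homotopy_extend[OF K le_add1[of _ S]]]
  note LD = grid_homotopyD[OF grid_homotopy_extend[OF L le_add2[of _ R]]]
  let ?H = "\<lambda>s t. if s \<le> int M then ?K s t else ?L (s - (int M + 1)) t"
  have "grid_homotopy Y y0 (M + N + 1) (R + S) ?H
      ?c ?c'"
  proof (rule grid_homotopyI)
    fix s t s' t'
    assume *: "0 \<le> s" "s \<le> int (M + N + 1)" "0 \<le> t" "t \<le> int (R + S)"
      "0 \<le> s'" "s' \<le> int (M + N + 1)" "0 \<le> t'" "t' \<le> int (R + S)"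
      "\<bar>s - s'\<bar> \<le> 1" "\<bar>t - t'\<bar> \<le> 1"
    have "s \<le> int M \<and> s' \<le> int M \<or> int M < s \<and> int M < s' \<or> s = int M \<and> s' = int M + 1 \<or> s' = int M \<and> s = int M + 1"
      using *(9) by linarith
    then consider "s \<le> int M" "s' \<le> int M" | "int M < s" "int M < s'" | "s = int M" "s' = int M + 1"
      | "s' = int M" "s = int M + 1"
      by blast
    then show "adj (?H s t) (?H s' t')"
    proof cases
      case 1
      then show ?thesis using KD(2)[of s t s' t'] * by simp
    next
      case 2
      then show ?thesis
        using LD(2)[of "s - (int M + 1)" t "s' - (int M + 1)" t'] * by simp
    next
      case 3
      then show ?thesis using KD(6)[of t] LD(5)[of t'] * by simp
    next
      case 4
      then show ?thesis using KD(6)[of t'] LD(5)[of t] * by simp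
    qed
  next
    fix s t assume "0 \<le> s" "s \<le> int (M + N + 1)" "0 \<le> t" "t \<le> int (R + S)"
    then show "?H s t \<in> Y"
      using KD(1)[of s t] LD(1)[of "s - (int M + 1)" t] by auto
  next
    fix s assume "0 \<le> s" "s \<le> int (M + N + 1)"
    then show "?H s 0 = ?c (vec s)"
      using KD(3)[of s] LD(3)[of "s - (int M + 1)"] by (auto simp: snd_loop_concat)
  next
    fix s assume "0 \<le> s" "s \<le> int (M + N + 1)"
    then show "?H s (int (R + S)) = ?c' (vec s)"
      using KD(4)[of s] LD(4)[of "s - (int M + 1)"] by (auto simp: snd_loop_concat)
  next
    fix t assume "0 \<le> t" "t \<le> int (R + S)"
    then show "?H 0 t = y0" using KD(5)[of t] by simp
  next
    fix t assume "0 \<le> t" "t \<le> int (R + S)"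
    then show "?H (int (M + N + 1)) t = y0" using LD(6)[of t] by simp
  qed
  from based_homotopicI[OF this] show ?thesis
    unfolding a b by (simp add: loop_concat_def)
qed

lemma loop_concat_loops:
  "a \<in> loops Y y0 \<Longrightarrow> b \<in> loops Y y0 \<Longrightarrow> loop_concat a b \<in> loops Y y0"
  by (simp add: loops_iff_based_homotopic based_homotopic_concat)

text \<open>
  A homotopy must keep points adjacent when space and time change simultaneously. With slope at most
  \<open>1/2\<close> in space, the straight line from \<open>g\<close> to \<open>h\<close> changes by at most \<open>1/2\<close> when \<open>s\<close> does, and,
  spread over enough time steps, by at most \<open>1/2\<close> when \<open>t\<close> does. So it changes by at most \<open>1\<close> in
  total, and rounding down keeps it so.
\<close>

lemma based_homotopic_reparametrization:
  fixes g h :: "int \<Rightarrow> real"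
  assumes c: "c \<in> loops Y y0" and L: "1 \<le> L"
    and g: "\<And>s. 0 \<le> s \<Longrightarrow> s \<le> int L \<Longrightarrow> 0 \<le> g s \<and> g s < real (fst c + 1)"
    and h: "\<And>s. 0 \<le> s \<Longrightarrow> s \<le> int L \<Longrightarrow> 0 \<le> h s \<and> h s < real (fst c + 1)"
    and g_lip: "\<And>s. 0 \<le> s \<Longrightarrow> s < int L \<Longrightarrow> \<bar>g (s + 1) - g s\<bar> \<le> 1 / 2"
    and h_lip: "\<And>s. 0 \<le> s \<Longrightarrow> s < int L \<Longrightarrow> \<bar>h (s + 1) - h s\<bar> \<le> 1 / 2"
    and start: "g 0 < 1" "h 0 < 1"
    and last: "real (fst c) \<le> g (int L)" "real (fst c) \<le> h (int L)"
  shows "based_homotopic Y y0 (L, \<lambda>s. snd c (vec \<lfloor>g (s $ 1)\<rfloor>)) (L, \<lambda>s. snd c (vec \<lfloor>h (s $ 1)\<rfloor>))"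
proof -
  obtain N \<gamma> where cN: "c = (N, \<gamma>)" by (cases c)
  have \<gamma>: "\<gamma> (vec i) \<in> Y" if "0 \<le> i" "i \<le> int N" for i
    using c that unfolding cN loops_def digitally_continuous_def interval_def by auto
  have \<gamma>_adj: "adj (\<gamma> (vec i)) (\<gamma> (vec j))"
    if "0 \<le> i" "i \<le> int N" "0 \<le> j" "j \<le> int N" "\<bar>i - j\<bar> \<le> 1" for i j
    using c that unfolding cN loops_def digitally_continuous_def interval_def by auto
  have \<gamma>_ends: "\<gamma> (vec 0) = y0" "\<gamma> (vec (int N)) = y0"
    using c unfolding cN loops_def by auto
  \<comment> \<open>Since \<open>g\<close> and \<open>h\<close> differ by at most \<open>N + 1\<close>, this many steps make each step at most \<open>1/2\<close>.\<close>
  define R where "R = 2 * (N + 1)"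
  define G where "G s t = g s + of_int t / real R * (h s - g s)" for s t
  have convex: "min (g s) (h s) \<le> G s t \<and> G s t \<le> max (g s) (h s)" if "0 \<le> t" "t \<le> int R" for s t
  proof -
    define u where "u = of_int t / real R"
    have u: "0 \<le> u" "u \<le> 1" using that by (auto simp: u_def R_def divide_simps)
    have "G s t = g s + u * (h s - g s)" by (simp add: G_def u_def)
    then have G: "G s t = (1 - u) * g s + u * h s" by (simp add: algebra_simps)
    have "(1 - u) * min (g s) (h s) + u * min (g s) (h s) \<le> G s t"
      unfolding G using u by (intro add_mono mult_left_mono) auto
    moreover have "G s t \<le> (1 - u) * max (g s) (h s) + u * max (g s) (h s)"
      unfolding G using u by (intro add_mono mult_left_mono) auto
    ultimately show ?thesis by (simp add: algebra_simps)
  qed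
  have G_range: "0 \<le> \<lfloor>G s t\<rfloor>" "\<lfloor>G s t\<rfloor> \<le> int N"
    if "0 \<le> s" "s \<le> int L" "0 \<le> t" "t \<le> int R" for s t
  proof -
    have "0 \<le> G s t" "G s t < real N + 1"
      using convex[of t s] g[of s] h[of s] that unfolding cN by auto
    then show "0 \<le> \<lfloor>G s t\<rfloor>" "\<lfloor>G s t\<rfloor> \<le> int N" by (simp, linarith)
  qed
  have lip: "\<bar>f s - f s'\<bar> \<le> 1 / 2"
    if f: "\<And>s. 0 \<le> s \<Longrightarrow> s < int L \<Longrightarrow> \<bar>f (s + 1) - f s\<bar> \<le> 1 / 2"
      and s: "0 \<le> s" "s \<le> int L" "0 \<le> s'" "s' \<le> int L" "\<bar>s - s'\<bar> \<le> 1" for f :: "int \<Rightarrow> real" and s s'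
  proof -
    consider "s' = s" | "s' = s + 1" | "s = s' + 1" using s(5) by linarith
    then show ?thesis
      using f[of s] f[of s'] s(1-4) by cases (auto simp: abs_minus_commute)
  qed
  have G_adj: "\<bar>\<lfloor>G s t\<rfloor> - \<lfloor>G s' t'\<rfloor>\<bar> \<le> 1"
    if *: "0 \<le> s" "s \<le> int L" "0 \<le> t" "t \<le> int R" "0 \<le> s'" "s' \<le> int L" "0 \<le> t'" "t' \<le> int R"
      "\<bar>s - s'\<bar> \<le> 1" "\<bar>t - t'\<bar> \<le> 1" for s t s' t'
  proof -
    define u where "u = of_int t / real R"
    have u: "0 \<le> u" "u \<le> 1" using * by (auto simp: u_def R_def divide_simps)
    have "G s t = g s + u * (h s - g s)" "G s' t = g s' + u * (h s' - g s')"
      by (simp_all add: G_def u_def)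
    then have "G s t - G s' t = (1 - u) * (g s - g s') + u * (h s - h s')"
      by (simp add: algebra_simps)
    also have "\<bar>\<dots>\<bar> \<le> (1 - u) * \<bar>g s - g s'\<bar> + u * \<bar>h s - h s'\<bar>"
      using u abs_triangle_ineq[of "(1 - u) * (g s - g s')" "u * (h s - h s')"]
      by (simp add: abs_mult)
    also have "\<dots> \<le> (1 - u) * (1 / 2) + u * (1 / 2)"
      using u lip[of g s s'] lip[of h s s'] g_lip h_lip * by (intro add_mono mult_left_mono) auto
    also have "(1 - u) * (1 / 2) + u * (1 / 2) = 1 / 2" by (simp add: field_simps)
    finally have 1: "\<bar>G s t - G s' t\<bar> \<le> 1 / 2" .
    have "G s' t - G s' t' = of_int (t - t') / real R * (h s' - g s')"
      by (simp add: G_def algebra_simps diff_divide_distrib)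
    also have "\<bar>\<dots>\<bar> = \<bar>of_int (t - t')\<bar> * \<bar>h s' - g s'\<bar> / real R"
      by (simp add: abs_mult)
    also have "\<dots> \<le> 1 * real (N + 1) / real R"
    proof (intro divide_right_mono mult_mono)
      show "\<bar>of_int (t - t')\<bar> \<le> (1::real)" using *(10) by linarith
      show "\<bar>h s' - g s'\<bar> \<le> real (N + 1)" using g[of s'] h[of s'] * unfolding cN by auto
    qed auto
    also have "\<dots> = 1 / 2" by (simp add: R_def divide_simps)
    finally have "\<bar>G s t - G s' t'\<bar> \<le> 1" using 1 by linarith
    then show ?thesis by linarith
  qed
  have "grid_homotopy Y y0 L R (\<lambda>s t. \<gamma> (vec \<lfloor>G s t\<rfloor>))
      (\<lambda>s. \<gamma> (vec \<lfloor>g (s $ 1)\<rfloor>)) (\<lambda>s. \<gamma> (vec \<lfloor>h (s $ 1)\<rfloor>))"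
  proof (rule grid_homotopyI)
    fix t assume t: "0 \<le> t" "t \<le> int R"
    have "G 0 t < 1" using convex[OF t, of 0] start by auto
    with G_range[of 0 t] t have "\<lfloor>G 0 t\<rfloor> = 0" by linarith
    then show "\<gamma> (vec \<lfloor>G 0 t\<rfloor>) = y0" using \<gamma>_ends by simp
  next
    fix t assume t: "0 \<le> t" "t \<le> int R"
    have "real N \<le> G (int L) t" using convex[OF t, of "int L"] last by (auto simp: cN)
    with G_range[of "int L" t] t have "\<lfloor>G (int L) t\<rfloor> = int N" by linarith
    then show "\<gamma> (vec \<lfloor>G (int L) t\<rfloor>) = y0" using \<gamma>_ends by simp
  next
    fix s show "\<gamma> (vec \<lfloor>G s 0\<rfloor>) = \<gamma> (vec \<lfloor>g (vec s $ 1)\<rfloor>)" by (simp add: G_def)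
  next
    fix s show "\<gamma> (vec \<lfloor>G s (int R)\<rfloor>) = \<gamma> (vec \<lfloor>h (vec s $ 1)\<rfloor>)" by (simp add: G_def R_def)
  qed (auto intro: \<gamma> \<gamma>_adj G_range G_adj)
  from based_homotopicI[OF this L] show ?thesis by (simp add: cN)
qed

text \<open>
  Let \<open>a\<close>, \<open>b\<close> have \<open>m\<close>, \<open>n\<close> points. Then \<open>a \<cdot> b\<close> has \<open>p = m + n\<close> points and the concatenation of the
  subdivided loops has \<open>q = k m + l n\<close>, so subdividing the former by \<open>q\<close> and the latter by \<open>p\<close> makes
  them equally long. Both are now reparametrisations of \<open>a \<cdot> b\<close>: one has constant slope \<open>1/q\<close>, the
  other has slope \<open>1/(k p)\<close> along \<open>a\<close> and \<open>1/(l p)\<close> along \<open>b\<close>. All slopes are at most \<open>1/2\<close>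
  because \<open>p\<close> and \<open>q\<close> are at least \<open>2\<close>.
\<close>

lemma concat_subdivide_loop_rel:
  assumes a: "a \<in> loops Y y0" and b: "b \<in> loops Y y0" and kl: "1 \<le> k" "1 \<le> l"
  shows "(loop_concat (subdivide k a) (subdivide l b), loop_concat a b) \<in> loop_rel Y y0"
proof -
  define m n p q where "m = fst a + 1" and "n = fst b + 1" and "p = m + n" and "q = k * m + l * n"
  \<comment> \<open>Where the part belonging to \<open>b\<close> begins.\<close>
  let ?J = "int (k * m * p)"
  have mn: "2 \<le> m" "2 \<le> n"
    using a b by (auto simp: m_def n_def loops_def)
  have km: "1 \<le> k * m" "1 \<le> l * n" "2 \<le> q" "2 \<le> p"
  proof -
    show "1 \<le> k * m" "1 \<le> l * n" using mult_le_mono[of 1 k 1 m] mult_le_mono[of 1 l 1 n] mn kl by simp_all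
    then show "2 \<le> q" "2 \<le> p" using mn unfolding q_def p_def by linarith+
  qed
  have pos: "0 < real k" "0 < real l" "0 < real p" "0 < real q" using kl km by auto
  have kp: "2 \<le> real (k * p)" "2 \<le> real (l * p)"
  proof -
    have "2 \<le> k * p" "2 \<le> l * p"
      using mult_le_mono[of 1 k 2 p] mult_le_mono[of 1 l 2 p] kl km by simp_all
    then show "2 \<le> real (k * p)" "2 \<le> real (l * p)" by linarith+
  qed
  let ?e = "loop_concat (subdivide k a) (subdivide l b)" and ?c = "loop_concat a b"
  have loops: "?e \<in> loops Y y0" "?c \<in> loops Y y0"
    using a b kl by (simp_all add: loop_concat_loops subdivide_loops)
  have len_sub: "fst (subdivide k a) = k * m - 1" "fst (subdivide l b) = l * n - 1"
    by (simp_all add: fst_subdivide m_def n_def)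
  have len_e: "fst ?e + 1 = q" using km by (simp add: fst_loop_concat len_sub q_def)
  have len_c: "fst ?c + 1 = p" by (simp add: fst_loop_concat m_def n_def p_def)
  define L where "L = p * q - 1"
  have L: "int L = int p * int q - 1" "1 \<le> L"
    using km mult_le_mono[of 2 p 2 q] by (auto simp: L_def of_nat_diff)
  define g where "g s = of_int s / real q" for s :: int
  define h where "h s = (if s \<le> ?J then of_int s / real (k * p)
                         else real m + of_int (s - ?J) / real (l * p))" for s :: int
  \<comment> \<open>Both formulas for \<open>h\<close> are valid at \<open>?J\<close>, so no step of \<open>h\<close> has to cross from one to the other.\<close>
  have h_first: "h s = of_int s / real (k * p)" if "s \<le> ?J" for s using that by (simp add: h_def)
  have h_second: "h s = real m + of_int (s - ?J) / real (l * p)" if "?J \<le> s" for s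
  proof (cases "s = ?J")
    case True
    have "real (k * m * p) / real (k * p) = real m" using pos by simp
    then show ?thesis using True by (simp add: h_def)
  qed (use that in \<open>simp add: h_def\<close>)
  have J_eq: "of_int (int L - ?J) = real l * real n * real p - 1"
    by (simp add: L q_def algebra_simps)
  have "based_homotopic Y y0 (L, \<lambda>s. snd ?c (vec \<lfloor>h (s $ 1)\<rfloor>)) (L, \<lambda>s. snd ?c (vec \<lfloor>g (s $ 1)\<rfloor>))"
  proof (rule based_homotopic_reparametrization[OF loops(2) L(2)])
    fix s :: int assume s: "0 \<le> s" "s \<le> int L"
    then have "s < int p * int q" by (simp add: L)
    then have "real_of_int s < real p * real q"
      by (metis of_int_less_iff of_int_mult of_int_of_nat_eq)
    then show "0 \<le> g s \<and> g s < real (fst ?c + 1)"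
      using s pos unfolding len_c by (simp add: g_def divide_simps)
    show "0 \<le> h s \<and> h s < real (fst ?c + 1)"
    proof (cases "s \<le> ?J")
      case True
      then have "real_of_int s \<le> real_of_int ?J" by (simp only: of_int_le_iff)
      then have "real_of_int s \<le> real m * real (k * p)" by (simp add: mult_ac)
      then have "h s \<le> real m"
        using pos unfolding h_first[OF True] by (subst pos_divide_le_eq) simp_all
      then show ?thesis
        using s pos mn h_first[OF True] unfolding len_c p_def by (simp add: p_def)
    next
      case False
      have "of_int (s - ?J) \<le> (of_int (int L - ?J) :: real)" using s by simp
      then have "of_int (s - ?J) < real n * real (l * p)" unfolding J_eq by (simp add: mult_ac)
      then have "of_int (s - ?J) / real (l * p) < real n" using pos by (simp add: divide_less_eq)
      moreover have "0 \<le> s - ?J" using False by simp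
      then have "0 \<le> real_of_int (s - ?J)" by (simp only: of_int_0_le_iff)
      then have "0 \<le> real_of_int (s - ?J) / real (l * p)" by (rule divide_nonneg_nonneg) simp
      ultimately show ?thesis using h_second[of s] False unfolding len_c p_def by auto
    qed
  next
    fix s :: int
    show "\<bar>g (s + 1) - g s\<bar> \<le> 1 / 2"
      using km by (simp add: g_def divide_simps)
    have half: "\<bar>1 / x\<bar> \<le> 1 / 2" if "2 \<le> x" for x :: real
      using that by (simp add: divide_simps)
    show "\<bar>h (s + 1) - h s\<bar> \<le> 1 / 2"
    proof (cases "s + 1 \<le> ?J")
      case True
      then have "h (s + 1) - h s = 1 / real (k * p)" by (simp add: h_first add_divide_distrib)
      with half[OF kp(1)] show ?thesis by simp
    next
      case False
      then have "h (s + 1) - h s = 1 / real (l * p)"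
        by (simp add: h_second add_divide_distrib diff_divide_distrib)
      with half[OF kp(2)] show ?thesis by simp
    qed
  next
    show "g 0 < 1" "h 0 < 1" by (simp_all add: g_def h_def)
    have "real (fst ?c) = real p - 1" using len_c by simp
    moreover have "g (int L) = real p - 1 / real q"
      using pos by (simp add: g_def L diff_divide_distrib)
    moreover have "1 / real q \<le> 1" using km by (subst divide_le_eq_1) simp
    ultimately show "real (fst ?c) \<le> g (int L)" by linarith
    have "of_int (int L - ?J) = real n * real (l * p) - 1" unfolding J_eq by (simp add: mult_ac)
    then have "of_int (int L - ?J) / real (l * p) = real n - 1 / real (l * p)"
      using pos by (simp add: diff_divide_distrib)
    moreover have "1 / real (l * p) \<le> 1" using kp(2) by (subst divide_le_eq_1) simp
    moreover have "?J \<le> int L"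
    proof -
      have "1 \<le> l * n * p" using mult_le_mono[of 1 "l * n" 1 p] km by simp
      moreover have "p * q = k * m * p + l * n * p" by (simp add: q_def algebra_simps)
      ultimately have "k * m * p \<le> L" unfolding L_def by linarith
      then show ?thesis by (simp only: of_nat_le_iff)
    qed
    ultimately show "real (fst ?c) \<le> h (int L)"
      using \<open>real (fst ?c) = real p - 1\<close> h_second[of "int L"] by (simp only: p_def of_nat_add)
  qed
  moreover have "based_homotopic Y y0 (subdivide p ?e) (L, \<lambda>s. snd ?c (vec \<lfloor>h (s $ 1)\<rfloor>))"
  proof (rule based_homotopic_cong)
    show "subdivide p ?e \<in> loops Y y0" using loops km by (simp add: subdivide_loops)
    show "fst (subdivide p ?e) = fst (L, \<lambda>s. snd ?c (vec \<lfloor>h (s $ 1)\<rfloor>))"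
      using len_e by (simp add: fst_subdivide L_def)
    fix s assume s: "0 \<le> s" "s \<le> int (fst (subdivide p ?e))"
    have flr: "\<lfloor>of_int x / real y\<rfloor> = x div int y" for x y
      using floor_divide_of_int_eq[of x "int y", where ?'a = real] by simp
    have div_div: "x div int y div int z = x div int (z * y)" for x y z
      using zdiv_zmult2_eq[of "int z" x "int y"] by (simp add: mult.commute)
    have "snd ?e (vec (s div int p)) = snd ?c (vec \<lfloor>h s\<rfloor>)"
    proof (cases "s < ?J")
      case True
      have "s div int p < int (k * m)"
        using True km by (simp add: int_div_less_iff)
      moreover have "s div int p div int k = \<lfloor>h s\<rfloor>"
        using True by (simp only: h_first less_imp_le flr div_div)
      moreover have "s div int p div int k < int m"
        using calculation(1) kl by (simp add: int_div_less_iff mult.commute)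
      ultimately show ?thesis
        using km by (simp add: snd_loop_concat len_sub snd_subdivide m_def of_nat_diff)
    next
      case False
      have fh: "\<lfloor>h s\<rfloor> = int m + (s - ?J) div int (l * p)"
        using h_second[of s] False flr[of "s - ?J" "l * p"] by simp
      have sp: "s div int p - int (k * m) = (s - ?J) div int p"
      proof -
        have "s div int p = ((s - ?J) + int (k * m) * int p) div int p" by simp
        also have "\<dots> = int (k * m) + (s - ?J) div int p"
          using km by (intro div_mult_self1) auto
        finally show ?thesis by simp
      qed
      have "0 \<le> (s - ?J) div int p" "0 \<le> (s - ?J) div int (l * p)"
        using False km kl by (simp_all add: pos_imp_zdiv_nonneg_iff)
      moreover have "(s - ?J) div int p div int l = (s - ?J) div int (l * p)"
        by (rule div_div)
      ultimately show ?thesis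
        using km sp fh by (simp add: snd_loop_concat len_sub snd_subdivide m_def of_nat_diff)
    qed
    then show "snd (subdivide p ?e) (vec s) = snd (L, \<lambda>s. snd ?c (vec \<lfloor>h (s $ 1)\<rfloor>)) (vec s)"
      by (simp add: snd_subdivide)
  qed
  moreover have "(L, \<lambda>s. snd ?c (vec \<lfloor>g (s $ 1)\<rfloor>)) = subdivide q ?c"
  proof (rule prod_eqI)
    have "\<lfloor>g x\<rfloor> = x div int q" for x
      using floor_divide_of_int_eq[of x "int q", where ?'a = real] by (simp add: g_def)
    then show "snd (L, \<lambda>s. snd ?c (vec \<lfloor>g (s $ 1)\<rfloor>)) = snd (subdivide q ?c)"
      by (simp add: subdivide_def case_prod_beta rho_def fun_eq_iff)
  qed (use len_c in \<open>simp add: fst_subdivide L_def mult.commute\<close>)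
  ultimately have "based_homotopic Y y0 (subdivide p ?e) (subdivide q ?c)"
    by (metis based_homotopic_trans)
  moreover have "1 \<le> p" "1 \<le> q" using km by auto
  ultimately show ?thesis
    unfolding loop_rel_iff using loops by blast
qed

text \<open>
  Subdivide the two factors independently until they become homotopic to the subdivided
  representatives of the other side; \<open>concat_subdivide_loop_rel\<close> absorbs the subdivisions at both
  ends.
\<close>

lemma loop_concat_loop_rel:
  assumes "(a, a') \<in> loop_rel Y y0" and "(b, b') \<in> loop_rel Y y0"
  shows "(loop_concat a b, loop_concat a' b') \<in> loop_rel Y y0"
proof -
  obtain k l where kl: "1 \<le> k" "1 \<le> l" "a \<in> loops Y y0" "a' \<in> loops Y y0"
    "based_homotopic Y y0 (subdivide k a) (subdivide l a')"
    using assms(1) unfolding loop_rel_iff by blast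
  obtain k' l' where kl': "1 \<le> k'" "1 \<le> l'" "b \<in> loops Y y0" "b' \<in> loops Y y0"
    "based_homotopic Y y0 (subdivide k' b) (subdivide l' b')"
    using assms(2) unfolding loop_rel_iff by blast
  have "(loop_concat a b, loop_concat (subdivide k a) (subdivide k' b)) \<in> loop_rel Y y0"
    using kl kl' by (intro loop_rel_sym[OF concat_subdivide_loop_rel])
  also have "(loop_concat (subdivide k a) (subdivide k' b),
      loop_concat (subdivide l a') (subdivide l' b')) \<in> loop_rel Y y0"
    using kl kl' by (intro loop_rel_if_based_homotopic based_homotopic_concat)
  also (loop_rel_trans) have "(loop_concat (subdivide l a') (subdivide l' b'), loop_concat a' b') \<in> loop_rel Y y0"
    using kl kl' by (intro concat_subdivide_loop_rel)
  finally (loop_rel_trans) show ?thesis .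
qed

section \<open>Multiplication and induced maps on classes\<close>

lemma loop_class_eq_iff:
  "a \<in> loops Y y0 \<Longrightarrow> b \<in> loops Y y0 \<Longrightarrow>
    loop_class Y y0 a = loop_class Y y0 b \<longleftrightarrow> (a, b) \<in> loop_rel Y y0"
  unfolding loop_class_def by (rule eq_equiv_class_iff[OF equiv_loop_rel])

lemma carrier_fundamental_group:
  "carrier (fundamental_group Y y0) = loop_class Y y0 ` loops Y y0"
  by (auto simp: fundamental_group_def quotient_def loop_class_def)

lemma mult_loop_class:
  assumes "a \<in> loops Y y0" "b \<in> loops Y y0"
  shows "loop_class Y y0 a \<otimes>\<^bsub>fundamental_group Y y0\<^esub> loop_class Y y0 b
    = loop_class Y y0 (loop_concat a b)"
proof -
  have "(\<lambda>a b. loop_class Y y0 (loop_concat a b)) respects2 loop_rel Y y0"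
  proof (rule congruent2I')
    fix a a' b b' assume r: "(a, a') \<in> loop_rel Y y0" "(b, b') \<in> loop_rel Y y0"
    then have "loop_concat a b \<in> loops Y y0" "loop_concat a' b' \<in> loops Y y0"
      by (auto simp: loop_rel_iff intro: loop_concat_loops)
    then show "loop_class Y y0 (loop_concat a b) = loop_class Y y0 (loop_concat a' b')"
      using loop_concat_loop_rel[OF r] by (simp add: loop_class_eq_iff)
  qed
  from UN_equiv_class2[OF equiv_loop_rel equiv_loop_rel this assms]
  show ?thesis by (simp add: fundamental_group_def loop_class_def)
qed

definition loop_map :: "(int ^ 'm \<Rightarrow> int ^ 'n) \<Rightarrow> 'm dloop \<Rightarrow> 'n dloop" where
  "loop_map f a = (fst a, f \<circ> snd a)"

lemma fst_loop_map [simp]: "fst (loop_map f a) = fst a"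
  by (simp add: loop_map_def)

lemma subdivide_loop_map: "subdivide k (loop_map f a) = loop_map f (subdivide k a)"
  by (simp add: subdivide_def loop_map_def case_prod_beta comp_assoc)

lemma loop_map_concat: "loop_map f (loop_concat a b) = loop_concat (loop_map f a) (loop_map f b)"
  by (auto simp: loop_concat_def loop_map_def case_prod_beta fun_eq_iff)

locale based_map =
  fixes X :: "(int ^ 'm::finite) set" and x0 :: "int ^ 'm"
    and Y :: "(int ^ 'n::finite) set" and y0 :: "int ^ 'n" and f :: "int ^ 'm \<Rightarrow> int ^ 'n"
  assumes continuous: "digitally_continuous X Y f" and base: "f x0 = y0"
begin

lemma based_homotopic_loop_map:
  assumes "based_homotopic X x0 a b" shows "based_homotopic Y y0 (loop_map f a) (loop_map f b)"
proof -
  obtain M \<alpha> \<beta> R K where ab: "a = (M, \<alpha>)" "b = (M, \<beta>)" "1 \<le> M"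
    and K: "grid_homotopy X x0 M R K \<alpha> \<beta>"
    using assms by (elim based_homotopicE)
  have "grid_homotopy Y y0 M R (\<lambda>s t. f (K s t)) (f \<circ> \<alpha>) (f \<circ> \<beta>)"
    by (rule grid_homotopyI)
       (use grid_homotopyD[OF K] base continuous in \<open>auto simp: digitally_continuous_def\<close>)
  from based_homotopicI[OF this ab(3)] show ?thesis by (simp add: ab loop_map_def)
qed

lemma loop_map_loops: "a \<in> loops X x0 \<Longrightarrow> loop_map f a \<in> loops Y y0"
  by (simp add: loops_iff_based_homotopic based_homotopic_loop_map)

lemma loop_map_loop_rel:
  assumes "(a, b) \<in> loop_rel X x0" shows "(loop_map f a, loop_map f b) \<in> loop_rel Y y0"
  using assms based_homotopic_loop_map loop_map_loops
  unfolding loop_rel_iff subdivide_loop_map by blast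

lemma induced_loop_class:
  assumes "a \<in> loops X x0"
  shows "induced Y y0 f (loop_class X x0 a) = loop_class Y y0 (loop_map f a)"
proof -
  have "(\<lambda>a. loop_class Y y0 (loop_map f a)) respects loop_rel X x0"
  proof (rule congruentI)
    fix a b assume r: "(a, b) \<in> loop_rel X x0"
    then have "loop_map f a \<in> loops Y y0" "loop_map f b \<in> loops Y y0"
      by (auto simp: loop_rel_iff intro: loop_map_loops)
    then show "loop_class Y y0 (loop_map f a) = loop_class Y y0 (loop_map f b)"
      using loop_map_loop_rel[OF r] by (simp add: loop_class_eq_iff)
  qed
  from UN_equiv_class[OF equiv_loop_rel this assms]
  show ?thesis by (simp add: induced_def loop_class_def loop_map_def case_prod_beta)
qed

end

section \<open>Loops in a product\<close>

lemma proj_vec_append [simp]: "proj1 (vec_append x y) = x" "proj2 (vec_append x y) = y"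
  by (simp_all add: proj1_def proj2_def vec_eq_iff)

lemma vec_append_proj [simp]: "vec_append (proj1 z) (proj2 z) = z"
  by (auto simp: proj1_def proj2_def vec_append_def vec_eq_iff split: sum.splits)

lemma based_map_proj1: "based_map (digital_prod X Y) (vec_append x0 y0) X x0 proj1"
  by standard (auto simp: digitally_continuous_def digital_prod_def)

lemma based_map_proj2: "based_map (digital_prod X Y) (vec_append x0 y0) Y y0 proj2"
  by standard (auto simp: digitally_continuous_def digital_prod_def)

lemma vec_append_in_digital_prod: "x \<in> X \<Longrightarrow> y \<in> Y \<Longrightarrow> vec_append x y \<in> digital_prod X Y"
  by (auto simp: digital_prod_def)

text \<open>The length is taken from the first loop; pairs are formed only of loops of equal length.\<close>

definition loop_pair :: "'m::finite dloop \<Rightarrow> 'n::finite dloop \<Rightarrow> ('m + 'n) dloop" where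
  "loop_pair a b = (fst a, \<lambda>t. vec_append (snd a t) (snd b t))"

lemma loop_pair_proj: "loop_pair (loop_map proj1 c) (loop_map proj2 c) = c"
  by (simp add: loop_pair_def loop_map_def)

lemma proj1_loop_pair: "loop_map proj1 (loop_pair a b) = a"
  by (simp add: loop_pair_def loop_map_def comp_def)

lemma proj2_loop_pair: "fst a = fst b \<Longrightarrow> loop_map proj2 (loop_pair a b) = b"
  by (simp add: loop_pair_def loop_map_def comp_def)

lemma based_homotopic_loop_pair:
  assumes "based_homotopic X x0 a a'" and "based_homotopic Y y0 b b'" and "fst a = fst b"
  shows "based_homotopic (digital_prod X Y) (vec_append x0 y0) (loop_pair a b) (loop_pair a' b')"
proof -
  obtain M \<alpha> \<alpha>' R K where a: "a = (M, \<alpha>)" "a' = (M, \<alpha>')" "1 \<le> M"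
    and K: "grid_homotopy X x0 M R K \<alpha> \<alpha>'"
    using assms(1) by (elim based_homotopicE)
  obtain \<beta> \<beta>' S L where b: "b = (M, \<beta>)" "b' = (M, \<beta>')"
    and L: "grid_homotopy Y y0 M S L \<beta> \<beta>'"
    using assms(2,3) a by (auto elim: based_homotopicE)
  note KD = grid_homotopyD[OF grid_homotopy_extend[OF K le_add1[of _ S]]]
  note LD = grid_homotopyD[OF grid_homotopy_extend[OF L le_add2[of _ R]]]
  have "grid_homotopy (digital_prod X Y) (vec_append x0 y0) M (R + S)
      (\<lambda>s t. vec_append (K s (min t (int R))) (L s (min t (int S))))
      (\<lambda>t. vec_append (\<alpha> t) (\<beta> t)) (\<lambda>t. vec_append (\<alpha>' t) (\<beta>' t))"
    by (rule grid_homotopyI) (simp_all add: KD(1,2,5,6) LD(1,2,5,6) grid_homotopyD(3,4)[OF K] grid_homotopyD(3,4)[OF L]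
        vec_append_in_digital_prod)
  from based_homotopicI[OF this a(3)] show ?thesis by (simp add: loop_pair_def a b)
qed

text \<open>
  The factors \<open>k, l\<close> for the first coordinate and \<open>k', l'\<close> for the second both satisfy
  \<open>k (fst c + 1) = l (fst d + 1)\<close>. Hence \<open>k' l = k l'\<close>, and the factors \<open>k' k\<close> and \<open>k' l\<close> serve both
  coordinates at once.
\<close>

lemma loop_rel_prodI:
  assumes cd: "c \<in> loops (digital_prod X Y) (vec_append x0 y0)"
      "d \<in> loops (digital_prod X Y) (vec_append x0 y0)"
    and 1: "(loop_map proj1 c, loop_map proj1 d) \<in> loop_rel X x0"
    and 2: "(loop_map proj2 c, loop_map proj2 d) \<in> loop_rel Y y0"
  shows "(c, d) \<in> loop_rel (digital_prod X Y) (vec_append x0 y0)"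
proof -
  obtain k l where kl: "1 \<le> k" "1 \<le> l"
    "based_homotopic X x0 (subdivide k (loop_map proj1 c)) (subdivide l (loop_map proj1 d))"
    using 1 unfolding loop_rel_iff by blast
  obtain k' l' where kl': "1 \<le> k'" "1 \<le> l'"
    "based_homotopic Y y0 (subdivide k' (loop_map proj2 c)) (subdivide l' (loop_map proj2 d))"
    using 2 unfolding loop_rel_iff by blast
  \<comment> \<open>Equal lengths mean equal numbers of points: the truncated subtractions are from positive numbers.\<close>
  have pred: "i * (M + 1) = j * (N + 1)"
    if "i * (M + 1) - 1 = j * (N + 1) - 1" "1 \<le> i" "1 \<le> j" for i j M N :: nat
    using that by (cases i; cases j) auto
  have len: "k * (fst c + 1) = l * (fst d + 1)" "k' * (fst c + 1) = l' * (fst d + 1)"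
    using kl kl' by (auto intro!: pred simp: based_homotopic_def fst_subdivide
        simp del: mult_Suc_right add_Suc_right)
  have "(k' * l) * (fst d + 1) = k' * (k * (fst c + 1))"
    by (simp only: len(1) mult.assoc)
  also have "\<dots> = k * (k' * (fst c + 1))" by (rule mult.left_commute)
  also have "\<dots> = (k * l') * (fst d + 1)" by (simp only: len(2) mult.assoc)
  finally have eq: "k' * l = k * l'" by (simp only: mult_cancel2) simp
  have "based_homotopic X x0 (loop_map proj1 (subdivide (k' * k) c)) (loop_map proj1 (subdivide (k' * l) d))"
    using based_homotopic_subdivide[OF kl(3) kl'(1)] kl kl'
    by (simp add: subdivide_subdivide subdivide_loop_map)
  moreover have "based_homotopic Y y0 (loop_map proj2 (subdivide (k' * k) c)) (loop_map proj2 (subdivide (k' * l) d))"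
    using based_homotopic_subdivide[OF kl'(3) kl(1)] kl kl' unfolding eq
    by (simp add: subdivide_subdivide subdivide_loop_map mult.commute)
  ultimately have "based_homotopic (digital_prod X Y) (vec_append x0 y0)
      (loop_pair (loop_map proj1 (subdivide (k' * k) c)) (loop_map proj2 (subdivide (k' * k) c)))
      (loop_pair (loop_map proj1 (subdivide (k' * l) d)) (loop_map proj2 (subdivide (k' * l) d)))"
    by (rule based_homotopic_loop_pair) simp
  then have "based_homotopic (digital_prod X Y) (vec_append x0 y0)
      (subdivide (k' * k) c) (subdivide (k' * l) d)"
    by (simp only: loop_pair_proj)
  moreover have "1 \<le> k' * k" "1 \<le> k' * l" using kl kl' by auto
  ultimately show ?thesis unfolding loop_rel_iff using cd by blast
qed

text \<open>
  Subdividing each loop by the number of points of the other makes them equally long, so that they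
  can be paired.
\<close>

lemma ex_loop_in_prod:
  assumes a: "a \<in> loops X x0" and b: "b \<in> loops Y y0"
  obtains c where "c \<in> loops (digital_prod X Y) (vec_append x0 y0)"
    and "(loop_map proj1 c, a) \<in> loop_rel X x0" and "(loop_map proj2 c, b) \<in> loop_rel Y y0"
proof -
  let ?a = "subdivide (fst b + 1) a" and ?b = "subdivide (fst a + 1) b"
  have len: "fst ?a = fst ?b" by (simp add: fst_subdivide mult.commute)
  have ab: "?a \<in> loops X x0" "?b \<in> loops Y y0"
    using a b by (auto intro: subdivide_loops)
  show ?thesis
  proof (rule that[of "loop_pair ?a ?b"])
    show "loop_pair ?a ?b \<in> loops (digital_prod X Y) (vec_append x0 y0)"
      using ab len unfolding loops_iff_based_homotopic by (intro based_homotopic_loop_pair)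
    show "(loop_map proj1 (loop_pair ?a ?b), a) \<in> loop_rel X x0"
      unfolding proj1_loop_pair using a by (rule subdivide_loop_rel) simp
    show "(loop_map proj2 (loop_pair ?a ?b), b) \<in> loop_rel Y y0"
      unfolding proj2_loop_pair[OF len] using b by (rule subdivide_loop_rel) simp
  qed
qed

theorem theorem3p15:
  fixes X :: "(int ^ 'm::finite) set" and Y :: "(int ^ 'n::finite) set"
    and x0 :: "int ^ 'm" and y0 :: "int ^ 'n"
  assumes "digital_image X" and "digital_image Y" and "x0 \<in> X" and "y0 \<in> Y"
  shows "Psi X x0 Y y0 \<in> iso (fundamental_group (digital_prod X Y) (vec_append x0 y0))
           (fundamental_group X x0 \<times>\<times> fundamental_group Y y0)"
proof -
  let ?Z = "digital_prod X Y" and ?z = "vec_append x0 y0"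
  let ?p1 = "loop_map proj1 :: ('m + 'n) dloop \<Rightarrow> 'm dloop"
    and ?p2 = "loop_map proj2 :: ('m + 'n) dloop \<Rightarrow> 'n dloop"
  note p1 = based_map.loop_map_loops[OF based_map_proj1[of X Y x0 y0]]
    and p2 = based_map.loop_map_loops[OF based_map_proj2[of X Y x0 y0]]
  have Psi: "Psi X x0 Y y0 (loop_class ?Z ?z c) = (loop_class X x0 (?p1 c), loop_class Y y0 (?p2 c))"
    if "c \<in> loops ?Z ?z" for c
    using that by (simp add: Psi_def based_map.induced_loop_class[OF based_map_proj1]
        based_map.induced_loop_class[OF based_map_proj2])
  have "Psi X x0 Y y0 \<in> hom (fundamental_group ?Z ?z) (fundamental_group X x0 \<times>\<times> fundamental_group Y y0)"
  proof (rule homI)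
    fix A assume "A \<in> carrier (fundamental_group ?Z ?z)"
    then show "Psi X x0 Y y0 A \<in> carrier (fundamental_group X x0 \<times>\<times> fundamental_group Y y0)"
      by (auto simp: carrier_fundamental_group Psi p1 p2)
  next
    fix A B assume "A \<in> carrier (fundamental_group ?Z ?z)" "B \<in> carrier (fundamental_group ?Z ?z)"
    then obtain a b where "a \<in> loops ?Z ?z" "b \<in> loops ?Z ?z"
      and "A = loop_class ?Z ?z a" "B = loop_class ?Z ?z b"
      by (auto simp: carrier_fundamental_group)
    then show "Psi X x0 Y y0 (A \<otimes>\<^bsub>fundamental_group ?Z ?z\<^esub> B) =
        Psi X x0 Y y0 A \<otimes>\<^bsub>fundamental_group X x0 \<times>\<times> fundamental_group Y y0\<^esub> Psi X x0 Y y0 B"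
      by (simp add: mult_loop_class Psi loop_concat_loops p1 p2 loop_map_concat)
  qed
  moreover have "bij_betw (Psi X x0 Y y0) (carrier (fundamental_group ?Z ?z))
      (carrier (fundamental_group X x0 \<times>\<times> fundamental_group Y y0))"
  proof (rule bij_betw_imageI)
    show "inj_on (Psi X x0 Y y0) (carrier (fundamental_group ?Z ?z))"
    proof (rule inj_onI)
      fix A B assume AB: "A \<in> carrier (fundamental_group ?Z ?z)" "B \<in> carrier (fundamental_group ?Z ?z)"
        "Psi X x0 Y y0 A = Psi X x0 Y y0 B"
      then obtain c d where cd: "c \<in> loops ?Z ?z" "A = loop_class ?Z ?z c"
          "d \<in> loops ?Z ?z" "B = loop_class ?Z ?z d"
        by (auto simp: carrier_fundamental_group)
      then have "(?p1 c, ?p1 d) \<in> loop_rel X x0" "(?p2 c, ?p2 d) \<in> loop_rel Y y0"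
        using AB(3) by (simp_all add: Psi p1 p2 loop_class_eq_iff)
      then show "A = B"
        using loop_rel_prodI cd by (simp add: loop_class_eq_iff)
    qed
    have "P \<in> Psi X x0 Y y0 ` carrier (fundamental_group ?Z ?z)"
      if "P \<in> carrier (fundamental_group X x0 \<times>\<times> fundamental_group Y y0)" for P
    proof -
      obtain A B where P: "P = (A, B)" by (cases P)
      with that have "A \<in> loop_class X x0 ` loops X x0" "B \<in> loop_class Y y0 ` loops Y y0"
        by (simp_all add: carrier_fundamental_group)
      then obtain a b where ab: "a \<in> loops X x0" "b \<in> loops Y y0"
        and AB: "A = loop_class X x0 a" "B = loop_class Y y0 b"
        by blast
      obtain c where c: "c \<in> loops ?Z ?z" "(?p1 c, a) \<in> loop_rel X x0" "(?p2 c, b) \<in> loop_rel Y y0"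
        using ex_loop_in_prod[OF ab] by blast
      then have "P = Psi X x0 Y y0 (loop_class ?Z ?z c)"
        using ab c(2,3)[THEN loop_rel_sym] by (simp add: P AB Psi p1 p2 loop_class_eq_iff)
      then show ?thesis using c(1) by (auto simp: carrier_fundamental_group)
    qed
    moreover have "Psi X x0 Y y0 ` carrier (fundamental_group ?Z ?z)
        \<subseteq> carrier (fundamental_group X x0 \<times>\<times> fundamental_group Y y0)"
      by (auto simp: carrier_fundamental_group Psi p1 p2)
    ultimately show "Psi X x0 Y y0 ` carrier (fundamental_group ?Z ?z) =
        carrier (fundamental_group X x0 \<times>\<times> fundamental_group Y y0)" by blast
  qed
  ultimately show ?thesis by (simp add: iso_def)
qed

end
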